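(* For each modal Heyting algebra $\mathbf{M}=\langle\mathbf{H},\Box,\Diamond\rangle$, the map $\sigma_{\mathbf{H}}\colon H\to\mathcal{U}(X(\mathbf{H}))$, $\sigma_{\mathbf{H}}(a)=\{P\in X(\mathbf{H}): a\in P\}$, is a modal Heyting algebra isomorphism from $\langle\mathbf{H},\Box,\Diamond\rangle$ onto $\langle\mathcal{U}(X(\mathbf{H})),\Box_{\eta_\Box},\Diamond_{\eta_\Diamond}\rangle$.
   Context: A modal Heyting algebra is $\langle\mathbf{H},\Box,\Diamond\rangle$ with $\mathbf{H}$ a Heyting algebra and unary $\Box,\Diamond$ satisfying $\Box a\wedge\Diamond(-a\wedge b)=\bot$, where $-a=a\rightharpoonup\bot$. $X(\mathbf{H})$ is the Esakia space of prime filters ordered by inclusion with topology generated by the sets $\sigma_{\mathbf{H}}(a)$ and their complements; $\mathcal{U}(X(\mathbf{H}))$ is the Heyting algebra of its clopen up-sets (with $U\to V=\{P: {\uparrow}P\cap U\subseteq V\}$), and $\mathcal{D}(X(\mathbf{H}))$ the clopen down-sets. $\eta_\Box(P)=\{\sigma_{\mathbf{H}}(a): \Box a\in P\}$, $\eta_\Diamond(P)=\mathcal{D}(X(\mathbf{H}))\setminus\{X(\mathbf{H})\setminus\sigma_{\mathbf{H}}(a): \Diamond a\in P\}$, and for $U\in\mathcal{U}(X(\mathbf{H}))$: $\Box_{\eta_\Box}(U)=\{P: U\in\eta_\Box(P)\}$, $\Diamond_{\eta_\Diamond}(U)=\{P: X(\mathbf{H})\setminus U\notin\eta_\Diamond(P)\}$.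 *)

theory Defs
  imports "HOL-Analysis.Abstract_Topology" "HOL-Algebra.Lattice"
begin

record 'a heyting = "'a gorder" +
  imp :: "['a, 'a] \<Rightarrow> 'a" (infixr \<open>\<rightharpoonup>\<index>\<close> 65)

locale heyting_algebra = Lattice.bounded_lattice H for H (structure) +
  assumes imp_closed: "\<lbrakk>a \<in> carrier H; b \<in> carrier H\<rbrakk> \<Longrightarrow> a \<rightharpoonup> b \<in> carrier H"
    and residuation: "\<lbrakk>a \<in> carrier H; b \<in> carrier H; c \<in> carrier H\<rbrakk>
      \<Longrightarrow> c \<sqsubseteq> a \<rightharpoonup> b \<longleftrightarrow> a \<sqinter> c \<sqsubseteq> b"

definition neg :: "('a, 'm) heyting_scheme \<Rightarrow> 'a \<Rightarrow> 'a" (\<open>\<sim>\<index>_\<close> [81] 80)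
  where "\<sim>\<^bsub>H\<^esub> a = a \<rightharpoonup>\<^bsub>H\<^esub> \<bottom>\<^bsub>H\<^esub>"

record 'a modal_heyting = "'a heyting" +
  nec :: "'a \<Rightarrow> 'a" (\<open>\<box>\<index>_\<close> [81] 80)
  poss :: "'a \<Rightarrow> 'a" (\<open>\<diamond>\<index>_\<close> [81] 80)

text \<open>The identity below is the only condition on the modal operations; in particular neither of
  them is assumed to be monotone.\<close>

locale modal_heyting_algebra = heyting_algebra M for M (structure) +
  assumes nec_closed: "a \<in> carrier M \<Longrightarrow> \<box>a \<in> carrier M"
    and poss_closed: "a \<in> carrier M \<Longrightarrow> \<diamond>a \<in> carrier M"
    and nec_poss: "\<lbrakk>a \<in> carrier M; b \<in> carrier M\<rbrakk> \<Longrightarrow> \<box>a \<sqinter> \<diamond>(\<sim>a \<sqinter> b) = \<bottom>"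

definition heyting_hom :: "('a, 'm) heyting_scheme \<Rightarrow> ('b, 'n) heyting_scheme \<Rightarrow> ('a \<Rightarrow> 'b) set"
  where "heyting_hom H K = {h. h \<in> carrier H \<rightarrow> carrier K \<and>
    h \<bottom>\<^bsub>H\<^esub> = \<bottom>\<^bsub>K\<^esub> \<and> h \<top>\<^bsub>H\<^esub> = \<top>\<^bsub>K\<^esub> \<and>
    (\<forall>a\<in>carrier H. \<forall>b\<in>carrier H.
      h (a \<sqinter>\<^bsub>H\<^esub> b) = h a \<sqinter>\<^bsub>K\<^esub> h b \<and>
      h (a \<squnion>\<^bsub>H\<^esub> b) = h a \<squnion>\<^bsub>K\<^esub> h b \<and>
      h (a \<rightharpoonup>\<^bsub>H\<^esub> b) = h a \<rightharpoonup>\<^bsub>K\<^esub> h b)}"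

definition modal_heyting_hom ::
    "('a, 'm) modal_heyting_scheme \<Rightarrow> ('b, 'n) modal_heyting_scheme \<Rightarrow> ('a \<Rightarrow> 'b) set"
  where "modal_heyting_hom M N = {h \<in> heyting_hom M N.
    \<forall>a\<in>carrier M. h (\<box>\<^bsub>M\<^esub> a) = \<box>\<^bsub>N\<^esub> (h a) \<and> h (\<diamond>\<^bsub>M\<^esub> a) = \<diamond>\<^bsub>N\<^esub> (h a)}"

definition modal_heyting_iso ::
    "('a, 'm) modal_heyting_scheme \<Rightarrow> ('b, 'n) modal_heyting_scheme \<Rightarrow> ('a \<Rightarrow> 'b) set"
  where "modal_heyting_iso M N =
    {h \<in> modal_heyting_hom M N. bij_betw h (carrier M) (carrier N)}"

definition is_filter :: "('a, 'm) gorder_scheme \<Rightarrow> 'a set \<Rightarrow> bool"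
  where "is_filter H F \<longleftrightarrow> F \<subseteq> carrier H \<and> F \<noteq> {} \<and>
    (\<forall>a\<in>F. \<forall>b\<in>carrier H. a \<sqsubseteq>\<^bsub>H\<^esub> b \<longrightarrow> b \<in> F) \<and>
    (\<forall>a\<in>F. \<forall>b\<in>F. a \<sqinter>\<^bsub>H\<^esub> b \<in> F)"

definition prime_filters :: "('a, 'm) gorder_scheme \<Rightarrow> 'a set set"
  where "prime_filters H = {P. is_filter H P \<and> P \<noteq> carrier H \<and>
    (\<forall>a\<in>carrier H. \<forall>b\<in>carrier H. a \<squnion>\<^bsub>H\<^esub> b \<in> P \<longrightarrow> a \<in> P \<or> b \<in> P)}"

definition stone_map :: "('a, 'm) gorder_scheme \<Rightarrow> 'a \<Rightarrow> 'a set set" (\<open>\<sigma>\<index>\<close>)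
  where "\<sigma>\<^bsub>H\<^esub> a = {P \<in> prime_filters H. a \<in> P}"

definition prime_topology :: "('a, 'm) gorder_scheme \<Rightarrow> 'a set topology"
  where "prime_topology H = topology_generated_by
    ((\<sigma>\<^bsub>H\<^esub>) ` carrier H \<union> (\<lambda>a. prime_filters H - \<sigma>\<^bsub>H\<^esub> a) ` carrier H)"

definition clopen_upsets :: "('a, 'm) gorder_scheme \<Rightarrow> 'a set set set"
  where "clopen_upsets H = {U. openin (prime_topology H) U \<and> closedin (prime_topology H) U \<and>
    (\<forall>P\<in>U. \<forall>Q\<in>prime_filters H. P \<subseteq> Q \<longrightarrow> Q \<in> U)}"

definition clopen_downsets :: "('a, 'm) gorder_scheme \<Rightarrow> 'a set set set"
  where "clopen_downsets H = {D. openin (prime_topology H) D \<and> closedin (prime_topology H) D \<and>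
    (\<forall>P\<in>D. \<forall>Q\<in>prime_filters H. Q \<subseteq> P \<longrightarrow> Q \<in> D)}"

definition upset_imp :: "('a, 'm) gorder_scheme \<Rightarrow> 'a set set \<Rightarrow> 'a set set \<Rightarrow> 'a set set"
  where "upset_imp H U V = {P \<in> prime_filters H. {Q \<in> prime_filters H. P \<subseteq> Q} \<inter> U \<subseteq> V}"

definition eta_nec :: "('a, 'm) modal_heyting_scheme \<Rightarrow> 'a set \<Rightarrow> 'a set set set"
  where "eta_nec M P = {\<sigma>\<^bsub>M\<^esub> a | a. a \<in> carrier M \<and> \<box>\<^bsub>M\<^esub> a \<in> P}"

definition eta_poss :: "('a, 'm) modal_heyting_scheme \<Rightarrow> 'a set \<Rightarrow> 'a set set set"
  where "eta_poss M P =
    clopen_downsets M - {prime_filters M - \<sigma>\<^bsub>M\<^esub> a | a. a \<in> carrier M \<and> \<diamond>\<^bsub>M\<^esub> a \<in> P}"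

definition nbhd_nec ::
    "('a, 'm) gorder_scheme \<Rightarrow> ('a set \<Rightarrow> 'a set set set) \<Rightarrow> 'a set set \<Rightarrow> 'a set set"
  where "nbhd_nec H \<eta> U = {P \<in> prime_filters H. U \<in> \<eta> P}"

definition nbhd_poss ::
    "('a, 'm) gorder_scheme \<Rightarrow> ('a set \<Rightarrow> 'a set set set) \<Rightarrow> 'a set set \<Rightarrow> 'a set set"
  where "nbhd_poss H \<eta> U = {P \<in> prime_filters H. prime_filters H - U \<notin> \<eta> P}"

definition upset_algebra :: "('a, 'm) modal_heyting_scheme \<Rightarrow> 'a set set modal_heyting"
  where "upset_algebra M = \<lparr>carrier = clopen_upsets M, eq = (=), le = (\<subseteq>), imp = upset_imp M,
    nec = nbhd_nec M (eta_nec M), poss = nbhd_poss M (eta_poss M)\<rparr>"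

text \<open>Meets, joins and bounds of \<^term>\<open>upset_algebra M\<close> are the library's, computed from the
  inclusion order. The remaining lemmas confirm that they are the set-theoretic operations.\<close>

lemma (in heyting_algebra) topspace_prime_topology:
  "topspace (prime_topology H) = prime_filters H"
proof -
  have "P \<in> \<sigma>\<^bsub>H\<^esub> \<top>" if "P \<in> prime_filters H" for P
  proof -
    have F: "P \<subseteq> carrier H" "P \<noteq> {}" "\<forall>a\<in>P. \<forall>b\<in>carrier H. a \<sqsubseteq> b \<longrightarrow> b \<in> P"
      using that by (auto simp: prime_filters_def is_filter_def)
    then obtain a where "a \<in> P" "a \<in> carrier H" by blast
    then have "\<top> \<in> P" using F(3) top_higher[of a] top_closed by blast
    then show ?thesis using that by (simp add: stone_map_def)
  qed
  then have "prime_filters H \<subseteq> \<sigma>\<^bsub>H\<^esub> \<top>" by (rule subsetI)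
  then have "prime_filters H \<subseteq> topspace (prime_topology H)"
    using top_closed unfolding prime_topology_def topology_generated_by_topspace by auto
  moreover have "topspace (prime_topology H) \<subseteq> prime_filters H"
    unfolding prime_topology_def topology_generated_by_topspace by (auto simp: stone_map_def)
  ultimately show ?thesis by (intro equalityI)
qed

lemma partial_order_upset_algebra: "partial_order (upset_algebra M)"
  by unfold_locales (auto simp: upset_algebra_def)

lemma
  assumes U: "U \<in> clopen_upsets M" and V: "V \<in> clopen_upsets M"
  shows meet_upset_algebra: "U \<sqinter>\<^bsub>upset_algebra M\<^esub> V = U \<inter> V"
    and join_upset_algebra: "U \<squnion>\<^bsub>upset_algebra M\<^esub> V = U \<union> V"
proof -
  interpret A: partial_order "upset_algebra M" by (rule partial_order_upset_algebra)
  have I: "U \<inter> V \<in> clopen_upsets M" and J: "U \<union> V \<in> clopen_upsets M"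
    using U V by (auto simp: clopen_upsets_def)
  have g: "greatest (upset_algebra M) (U \<inter> V) (Lower (upset_algebra M) {U, V})"
    using U V I by (auto simp: greatest_def Lower_def upset_algebra_def)
  show "U \<sqinter>\<^bsub>upset_algebra M\<^esub> V = U \<inter> V"
    unfolding meet_def inf_def by (rule some_equality, rule g, erule A.greatest_unique[OF _ g])
  have g: "least (upset_algebra M) (U \<union> V) (Upper (upset_algebra M) {U, V})"
    using U V J by (auto simp: least_def Upper_def upset_algebra_def)
  show "U \<squnion>\<^bsub>upset_algebra M\<^esub> V = U \<union> V"
    unfolding join_def sup_def by (rule some_equality, rule g, erule A.least_unique[OF _ g])
qed

lemma bottom_upset_algebra: "\<bottom>\<^bsub>upset_algebra M\<^esub> = {}"
proof -
  interpret A: partial_order "upset_algebra M" by (rule partial_order_upset_algebra)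
  have g: "least (upset_algebra M) {} (carrier (upset_algebra M))"
    by (auto simp: least_def upset_algebra_def clopen_upsets_def)
  show ?thesis
    unfolding bottom_def by (rule some_equality, rule g, erule A.least_unique[OF _ g])
qed

lemma top_upset_algebra:
  assumes "heyting_algebra M"
  shows "\<top>\<^bsub>upset_algebra M\<^esub> = prime_filters M"
proof -
  interpret A: partial_order "upset_algebra M" by (rule partial_order_upset_algebra)
  interpret heyting_algebra M by fact
  have g: "greatest (upset_algebra M) (prime_filters M) (carrier (upset_algebra M))"
    using openin_topspace[of "prime_topology M"] closedin_topspace[of "prime_topology M"]
    by (auto simp: greatest_def upset_algebra_def clopen_upsets_def
        topspace_prime_topology
        dest: openin_subset[of "prime_topology M", unfolded topspace_prime_topology])
  show ?thesis
    unfolding top_def by (rule some_equality, rule g, erule A.greatest_unique[OF _ g])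
qed

end

theory Submission
  imports Defs "HOL-Analysis.Function_Topology"
begin

text \<open>Stone representation does most of the work. Separating a filter from a disjoint
  join-closed set by a prime filter shows that \<open>\<sigma>\<close> reflects the order, that it preserves
  implication, and (through Alexander's subbase theorem) that the prime filter space is compact.
  Compactness makes every clopen up-set a \<open>\<sigma> a\<close>. The neighbourhood maps are defined through
  \<open>\<sigma>\<close>, so by injectivity \<open>\<sigma>\<close> commutes with the modal operations, and the modal identity
  moves along \<open>\<sigma>\<close>.\<close>

section \<open>Alexander's subbase theorem for generated topologies\<close>

text \<open>\<open>Alexander_subbase\<close> speaks of arbitrary unions of finite intersections of
  \<open>\<B>\<close>, cut down to \<open>\<Union>\<B>\<close>. Such sets are generated by
  \<open>\<B>\<close>; conversely they form a topology containing \<open>\<B>\<close>, and the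
  generated one is the least such. So the two topologies agree.\<close>

lemma compact_space_topology_generated_by:
  assumes "\<And>C. \<lbrakk>C \<subseteq> \<B>; \<Union>C = \<Union>\<B>\<rbrakk> \<Longrightarrow> \<exists>C'. finite C' \<and> C' \<subseteq> C \<and> \<Union>C' = \<Union>\<B>"
  shows "compact_space (topology_generated_by \<B>)"
proof (rule Alexander_subbase)
  let ?T = "arbitrary union_of (finite intersection_of (\<lambda>x. x \<in> \<B>) relative_to \<Union>\<B>)"
  show "topology ?T = topology_generated_by \<B>"
  proof (rule arg_cong[where f = topology], rule ext, rule iffI)
    fix S
    assume "?T S"
    then obtain \<U> where U: "\<And>V. V \<in> \<U> \<Longrightarrow> (finite intersection_of (\<lambda>x. x \<in> \<B>) relative_to \<Union>\<B>) V"
      and S: "\<Union>\<U> = S"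
      by (auto simp: union_of_def arbitrary_def)
    have "generate_topology_on \<B> V" if V: "V \<in> \<U>" for V
    proof -
      obtain \<F> where F: "finite \<F>" "\<F> \<subseteq> \<B>" "V = \<Union>\<B> \<inter> \<Inter>\<F>"
        using U[OF V] by (auto simp: relative_to_def intersection_of_def)
      show ?thesis
      \<comment> \<open>The empty intersection, cut down to \<open>\<Union>\<B>\<close>, is
        \<open>\<Union>\<B>\<close> itself, which is open as a union of generators and not as a
        finite intersection of them.\<close>
      proof (cases "\<F> = {}")
        case True
        then show ?thesis
          using F generate_topology_on.UN[OF generate_topology_on.Basis, of \<B> \<B>] by simp
      next
        case False
        then have "V = \<Inter>\<F>" using F by auto
        then show ?thesis
          using F False generate_topology_on_Inter[of \<F> \<B>] generate_topology_on.Basis[of _ \<B>]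
          by blast
      qed
    qed
    then show "generate_topology_on \<B> S"
      unfolding S[symmetric] by (rule generate_topology_on.UN)
  next
    fix S
    assume "generate_topology_on \<B> S"
    moreover have "?T B" if "B \<in> \<B>" for B
    proof -
      have "(finite intersection_of (\<lambda>x. x \<in> \<B>)) B"
        using that by (simp add: finite_intersection_of_inc)
      moreover have "\<Union>\<B> \<inter> B = B"
        using that by auto
      ultimately have "(finite intersection_of (\<lambda>x. x \<in> \<B>) relative_to \<Union>\<B>) B"
        unfolding relative_to_def by blast
      then show ?thesis by (rule arbitrary_union_of_inc)
    qed
    ultimately show "?T S"
      using generate_topology_on_coarsest[OF istopology_subbase] by blast
  qed
qed (use assms in auto)

section \<open>Prime filters and their separation from join-closed sets\<close>

lemma prime_filtersD:
  assumes "P \<in> prime_filters H"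
  shows "P \<subseteq> carrier H" "P \<noteq> {}" "P \<noteq> carrier H"
    and "\<And>a b. \<lbrakk>a \<in> P; b \<in> carrier H; a \<sqsubseteq>\<^bsub>H\<^esub> b\<rbrakk> \<Longrightarrow> b \<in> P"
    and "\<And>a b. \<lbrakk>a \<in> P; b \<in> P\<rbrakk> \<Longrightarrow> a \<sqinter>\<^bsub>H\<^esub> b \<in> P"
    and "\<And>a b. \<lbrakk>a \<in> carrier H; b \<in> carrier H; a \<squnion>\<^bsub>H\<^esub> b \<in> P\<rbrakk> \<Longrightarrow> a \<in> P \<or> b \<in> P"
  using assms by (auto simp: prime_filters_def is_filter_def)

context heyting_algebra
begin

text \<open>By residuation, meeting with \<open>r\<close> has an upper adjoint and so respects
  joins. This is the share of distributivity on which primeness of a maximal filter rests.\<close>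

lemma meet_join_le:
  assumes "a \<in> carrier H" "b \<in> carrier H" "r \<in> carrier H" "s \<in> carrier H"
    and "a \<sqinter> r \<sqsubseteq> s" "b \<sqinter> r \<sqsubseteq> s"
  shows "(a \<squnion> b) \<sqinter> r \<sqsubseteq> s"
proof -
  have "a \<sqsubseteq> r \<rightharpoonup> s" "b \<sqsubseteq> r \<rightharpoonup> s"
    using assms by (simp_all add: residuation meet_comm)
  then have "a \<squnion> b \<sqsubseteq> r \<rightharpoonup> s"
    using assms by (simp add: join_le imp_closed)
  then show ?thesis
    using assms by (simp add: residuation meet_comm)
qed

lemma meet_mono:
  assumes "a \<in> carrier H" "b \<in> carrier H" "c \<in> carrier H" "d \<in> carrier H" "a \<sqsubseteq> c" "b \<sqsubseteq> d"
  shows "a \<sqinter> b \<sqsubseteq> c \<sqinter> d"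
  using assms by (meson le_trans meet_closed meet_le meet_left meet_right)

text \<open>The filter generated by \<open>F\<close> and \<open>a\<close> when \<open>F\<close> is a
  filter: a single \<open>p\<close> is enough because \<open>F\<close> is closed under
  meets.\<close>

definition adjoin :: "'a set \<Rightarrow> 'a \<Rightarrow> 'a set"
  where "adjoin F a = {c \<in> carrier H. \<exists>p\<in>F. a \<sqinter> p \<sqsubseteq> c}"

lemma
  assumes F: "is_filter H F" and a: "a \<in> carrier H"
  shows is_filter_adjoin: "is_filter H (adjoin F a)"
    and subset_adjoin: "F \<subseteq> adjoin F a"
    and mem_adjoin: "a \<in> adjoin F a"
proof -
  have FC: "F \<subseteq> carrier H" and F0: "F \<noteq> {}" and Fm: "\<And>x y. \<lbrakk>x \<in> F; y \<in> F\<rbrakk> \<Longrightarrow> x \<sqinter> y \<in> F"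
    using F by (auto simp: is_filter_def)
  show sub: "F \<subseteq> adjoin F a"
    using FC a meet_right unfolding adjoin_def by blast
  show mem: "a \<in> adjoin F a"
    using FC F0 a meet_left unfolding adjoin_def by blast
  have "x \<sqinter> y \<in> adjoin F a" if x: "x \<in> adjoin F a" and y: "y \<in> adjoin F a" for x y
  proof -
    obtain p q where p: "p \<in> F" "a \<sqinter> p \<sqsubseteq> x" and q: "q \<in> F" "a \<sqinter> q \<sqsubseteq> y"
      using x y by (auto simp: adjoin_def)
    have C: "x \<in> carrier H" "y \<in> carrier H" "p \<in> carrier H" "q \<in> carrier H"
      using x y p q FC by (auto simp: adjoin_def)
    \<comment> \<open>\<open>p \<sqinter> q\<close> lies in \<open>F\<close> and is a common witness
      for \<open>x\<close> and \<open>y\<close>.\<close>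
    have "a \<sqinter> (p \<sqinter> q) \<sqsubseteq> x"
      by (rule le_trans[OF meet_mono p(2)]) (use C a meet_left in auto)
    moreover have "a \<sqinter> (p \<sqinter> q) \<sqsubseteq> y"
      by (rule le_trans[OF meet_mono q(2)]) (use C a meet_right in auto)
    ultimately have "a \<sqinter> (p \<sqinter> q) \<sqsubseteq> x \<sqinter> y"
      using C a by (simp add: meet_le)
    then show ?thesis
      using Fm[OF p(1) q(1)] C by (auto simp: adjoin_def)
  qed
  moreover have "y \<in> adjoin F a" if "x \<in> adjoin F a" "y \<in> carrier H" "x \<sqsubseteq> y" for x y
    using that FC a unfolding adjoin_def by (blast intro: le_trans meet_closed)
  ultimately show "is_filter H (adjoin F a)"
    using mem by (auto simp: is_filter_def adjoin_def)
qed

text \<open>Zorn's lemma yields a filter maximal among those that contain \<open>F\<close> and miss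
  \<open>I\<close>. Were it not prime, adjoining either of two elements outside it would reach
  \<open>I\<close>, and distributivity would then put a join of two members of \<open>I\<close> into
  the filter. \<open>I\<close> is a join-closed set rather than an ideal so that a singleton
  \<open>{b}\<close> qualifies.\<close>

theorem prime_filter_separation:
  assumes F: "is_filter H F" and I: "I \<subseteq> carrier H" "I \<noteq> {}"
    and join: "\<And>i j. \<lbrakk>i \<in> I; j \<in> I\<rbrakk> \<Longrightarrow> i \<squnion> j \<in> I" and disj: "F \<inter> I = {}"
  obtains P where "P \<in> prime_filters H" "F \<subseteq> P" "P \<inter> I = {}"
proof -
  let ?A = "{G. is_filter H G \<and> F \<subseteq> G \<and> G \<inter> I = {}}"
  have "\<exists>P\<in>?A. \<forall>X\<in>?A. P \<subseteq> X \<longrightarrow> X = P"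
  proof (rule subset_Zorn_nonempty)
    show "?A \<noteq> {}" using F disj by auto
  next
    fix C
    assume C0: "C \<noteq> {}" and C: "subset.chain ?A C"
    have CA: "C \<subseteq> ?A" and lin: "\<And>X Y. \<lbrakk>X \<in> C; Y \<in> C\<rbrakk> \<Longrightarrow> X \<subseteq> Y \<or> Y \<subseteq> X"
      using C unfolding subset_chain_def by blast+
    have "x \<sqinter> y \<in> \<Union>C" if xy: "x \<in> \<Union>C" "y \<in> \<Union>C" for x y
    proof -
      obtain X Y where "X \<in> C" "Y \<in> C" "x \<in> X" "y \<in> Y" using xy by auto
      then obtain Z where "Z \<in> C" "x \<in> Z" "y \<in> Z" using lin by blast
      then show ?thesis using CA unfolding is_filter_def by blast
    qed
    moreover have "\<Union>C \<subseteq> carrier H"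
      using CA by (intro Union_least) (auto simp: is_filter_def)
    moreover have FC: "F \<subseteq> \<Union>C" and "\<Union>C \<inter> I = {}"
      using CA C0 by blast+
    moreover have "F \<noteq> {}"
      using F by (simp add: is_filter_def)
    with FC have "\<Union>C \<noteq> {}" by auto
    moreover have "y \<in> \<Union>C" if "x \<in> \<Union>C" "y \<in> carrier H" "x \<sqsubseteq> y" for x y
      using that CA unfolding is_filter_def by blast
    ultimately show "\<Union>C \<in> ?A"
      unfolding is_filter_def mem_Collect_eq by (intro conjI ballI impI)
  qed
  then obtain P where PA: "P \<in> ?A" and maxA: "\<forall>X\<in>?A. P \<subseteq> X \<longrightarrow> X = P" ..
  have P: "is_filter H P" "F \<subseteq> P" "P \<inter> I = {}"
    using PA by simp_all
  have max: "X = P" if "is_filter H X" "P \<subseteq> X" "X \<inter> I = {}" for X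
    using maxA that P(2) by simp
  have PC: "P \<subseteq> carrier H" and up: "\<And>x y. \<lbrakk>x \<in> P; y \<in> carrier H; x \<sqsubseteq> y\<rbrakk> \<Longrightarrow> y \<in> P"
    and meet: "\<And>x y. \<lbrakk>x \<in> P; y \<in> P\<rbrakk> \<Longrightarrow> x \<sqinter> y \<in> P"
    using P(1) unfolding is_filter_def by blast+
  \<comment> \<open>Maximality: \<open>adjoin P a\<close> is a filter strictly above
    \<open>P\<close>, so it must meet \<open>I\<close>.\<close>
  have hit: "\<exists>p\<in>P. \<exists>i\<in>I. a \<sqinter> p \<sqsubseteq> i" if a: "a \<in> carrier H" "a \<notin> P" for a
    using max[OF is_filter_adjoin[OF P(1) a(1)] subset_adjoin[OF P(1) a(1)]]
      mem_adjoin[OF P(1) a(1)] a(2) by (auto simp: adjoin_def)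
  have "a \<in> P \<or> b \<in> P" if ab: "a \<in> carrier H" "b \<in> carrier H" "a \<squnion> b \<in> P" for a b
  proof (rule ccontr)
    assume "\<not> (a \<in> P \<or> b \<in> P)"
    then obtain p i q j where p: "p \<in> P" "i \<in> I" "a \<sqinter> p \<sqsubseteq> i" and q: "q \<in> P" "j \<in> I" "b \<sqinter> q \<sqsubseteq> j"
      using hit ab by meson
    have C: "p \<in> carrier H" "q \<in> carrier H" "i \<in> carrier H" "j \<in> carrier H"
      using p q PC I by auto
    \<comment> \<open>Passing to \<open>p \<sqinter> q\<close> gives both cases the same element of
      \<open>P\<close>, and \<open>i \<squnion> j\<close> gives them the same bound, as
      \<open>meet_join_le\<close> requires.\<close>
    have "a \<sqinter> (p \<sqinter> q) \<sqsubseteq> i"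
      by (rule le_trans[OF meet_mono p(3)]) (use C ab meet_left in auto)
    then have 1: "a \<sqinter> (p \<sqinter> q) \<sqsubseteq> i \<squnion> j"
      by (rule le_trans[OF _ join_left]) (use C ab in auto)
    have "b \<sqinter> (p \<sqinter> q) \<sqsubseteq> j"
      by (rule le_trans[OF meet_mono q(3)]) (use C ab meet_right in auto)
    then have 2: "b \<sqinter> (p \<sqinter> q) \<sqsubseteq> i \<squnion> j"
      by (rule le_trans[OF _ join_right]) (use C ab in auto)
    have "(a \<squnion> b) \<sqinter> (p \<sqinter> q) \<sqsubseteq> i \<squnion> j"
      by (rule meet_join_le[OF _ _ _ _ 1 2]) (use C ab in auto)
    moreover have "(a \<squnion> b) \<sqinter> (p \<sqinter> q) \<in> P"
      using meet p q ab by blast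
    ultimately have "i \<squnion> j \<in> P"
      using up C by simp
    then show False
      using join p q P(3) by blast
  qed
  moreover have "P \<noteq> carrier H"
    using P(3) I by auto
  ultimately have "P \<in> prime_filters H"
    using P(1) by (auto simp: prime_filters_def)
  then show ?thesis using that P by blast
qed

section \<open>The Stone map as an embedding of Heyting algebras\<close>

lemma top_in_prime_filter: "P \<in> prime_filters H \<Longrightarrow> \<top> \<in> P"
  using prime_filtersD[of P H] by (metis ex_in_conv subsetD top_closed top_higher)

lemma bottom_notin_prime_filter: "P \<in> prime_filters H \<Longrightarrow> \<bottom> \<notin> P"
  using prime_filtersD[of P H] bottom_lower by blast

lemma stone_map_bottom: "\<sigma> \<bottom> = {}"
  using bottom_notin_prime_filter by (auto simp: stone_map_def)

lemma stone_map_top: "\<sigma> \<top> = prime_filters H"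
  using top_in_prime_filter by (auto simp: stone_map_def)

lemma stone_map_meet:
  assumes "a \<in> carrier H" "b \<in> carrier H"
  shows "\<sigma> (a \<sqinter> b) = \<sigma> a \<inter> \<sigma> b"
proof -
  have "a \<sqinter> b \<in> P \<longleftrightarrow> a \<in> P \<and> b \<in> P" if P: "P \<in> prime_filters H" for P
    using prime_filtersD(4)[OF P _ assms(1) meet_left[OF assms]]
      prime_filtersD(4)[OF P _ assms(2) meet_right[OF assms]] prime_filtersD(5)[OF P] by metis
  then show ?thesis by (auto simp: stone_map_def)
qed

lemma stone_map_join:
  assumes "a \<in> carrier H" "b \<in> carrier H"
  shows "\<sigma> (a \<squnion> b) = \<sigma> a \<union> \<sigma> b"
proof -
  have "a \<squnion> b \<in> P \<longleftrightarrow> a \<in> P \<or> b \<in> P" if P: "P \<in> prime_filters H" for P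
    using prime_filtersD(4)[OF P _ join_closed[OF assms] join_left[OF assms]]
      prime_filtersD(4)[OF P _ join_closed[OF assms] join_right[OF assms]]
      prime_filtersD(6)[OF P assms] by metis
  then show ?thesis by (auto simp: stone_map_def)
qed

text \<open>From left to right this is modus ponens inside \<open>Q\<close>. Conversely, if
  \<open>a \<rightharpoonup> b\<close> is not in \<open>P\<close>, residuation shows that no
  \<open>a \<sqinter> p\<close> with \<open>p \<in> P\<close> is below \<open>b\<close>. The filter
  generated by \<open>P\<close> and \<open>a\<close> therefore misses \<open>b\<close>, and
  separation extends it to a prime filter that refutes the right-hand side.\<close>

lemma stone_map_imp:
  assumes a: "a \<in> carrier H" and b: "b \<in> carrier H"
  shows "\<sigma> (a \<rightharpoonup> b) = upset_imp H (\<sigma> a) (\<sigma> b)"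
proof -
  have mp: "a \<sqinter> (a \<rightharpoonup> b) \<sqsubseteq> b"
    using a b residuation[of a b "a \<rightharpoonup> b"] by (simp add: imp_closed)
  have "a \<rightharpoonup> b \<in> P \<longleftrightarrow> (\<forall>Q\<in>prime_filters H. P \<subseteq> Q \<longrightarrow> a \<in> Q \<longrightarrow> b \<in> Q)"
    if P: "P \<in> prime_filters H" for P
  proof
    assume "a \<rightharpoonup> b \<in> P"
    then show "\<forall>Q\<in>prime_filters H. P \<subseteq> Q \<longrightarrow> a \<in> Q \<longrightarrow> b \<in> Q"
      using mp b by (meson prime_filtersD(4,5) subsetD)
  next
    assume *: "\<forall>Q\<in>prime_filters H. P \<subseteq> Q \<longrightarrow> a \<in> Q \<longrightarrow> b \<in> Q"
    have F: "is_filter H P" using P by (simp add: prime_filters_def)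
    show "a \<rightharpoonup> b \<in> P"
    proof (rule ccontr)
      assume "a \<rightharpoonup> b \<notin> P"
      then have "\<not> a \<sqinter> p \<sqsubseteq> b" if "p \<in> P" for p
        using that prime_filtersD[OF P] a b residuation imp_closed by (meson subsetD)
      then have "adjoin P a \<inter> {b} = {}" by (auto simp: adjoin_def)
      moreover have "b \<squnion> b = b" using b le_iff_meet by auto
      ultimately obtain Q where "Q \<in> prime_filters H" "adjoin P a \<subseteq> Q" "Q \<inter> {b} = {}"
        using prime_filter_separation[OF is_filter_adjoin[OF F a], of "{b}"] b by auto
      then show False
        using * subset_adjoin[OF F a] mem_adjoin[OF F a] by blast
    qed
  qed
  then show ?thesis by (auto simp: stone_map_def upset_imp_def)
qed

text \<open>Order reflection separates the principal filter of \<open>a\<close> from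
  \<open>{b}\<close>: if \<open>a\<close> is not below \<open>b\<close>, some prime filter contains
  \<open>a\<close> and omits \<open>b\<close>.\<close>

lemma stone_map_subset_iff:
  assumes a: "a \<in> carrier H" and b: "b \<in> carrier H"
  shows "\<sigma> a \<subseteq> \<sigma> b \<longleftrightarrow> a \<sqsubseteq> b"
proof
  assume "a \<sqsubseteq> b"
  then show "\<sigma> a \<subseteq> \<sigma> b"
    using b prime_filtersD(4) by (fastforce simp: stone_map_def)
next
  assume sub: "\<sigma> a \<subseteq> \<sigma> b"
  have F: "is_filter H {c \<in> carrier H. a \<sqsubseteq> c}"
    using a by (auto simp: is_filter_def intro: meet_le le_trans)
  show "a \<sqsubseteq> b"
  proof (rule ccontr)
    assume "\<not> a \<sqsubseteq> b"
    then have "{c \<in> carrier H. a \<sqsubseteq> c} \<inter> {b} = {}" by auto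
    moreover have "b \<squnion> b = b" using b le_iff_meet by auto
    ultimately obtain P where "P \<in> prime_filters H" "{c \<in> carrier H. a \<sqsubseteq> c} \<subseteq> P" "P \<inter> {b} = {}"
      using prime_filter_separation[OF F, of "{b}"] b by auto
    then show False
      using sub a by (auto simp: stone_map_def)
  qed
qed

lemma inj_on_stone_map: "inj_on (\<sigma>) (carrier H)"
  by (rule inj_onI) (metis le_antisym stone_map_subset_iff subset_refl)

section \<open>Clopenness of the basic sets\<close>

lemma openin_stone_map:
  "a \<in> carrier H \<Longrightarrow> openin (prime_topology H) (\<sigma> a)"
  "a \<in> carrier H \<Longrightarrow> openin (prime_topology H) (prime_filters H - \<sigma> a)"
  by (auto simp: prime_topology_def intro!: topology_generated_by_Basis)

lemma stone_map_subset_prime_filters: "\<sigma> a \<subseteq> prime_filters H"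
  by (auto simp: stone_map_def)

lemma closedin_stone_map: "a \<in> carrier H \<Longrightarrow> closedin (prime_topology H) (\<sigma> a)"
  by (simp add: closedin_def topspace_prime_topology openin_stone_map stone_map_subset_prime_filters)

lemma stone_map_clopen_upset: "a \<in> carrier H \<Longrightarrow> \<sigma> a \<in> clopen_upsets H"
  by (auto simp: clopen_upsets_def openin_stone_map closedin_stone_map)
    (auto simp: stone_map_def)

lemma compl_stone_map_clopen_downset:
  "a \<in> carrier H \<Longrightarrow> prime_filters H - \<sigma> a \<in> clopen_downsets H"
  using openin_stone_map[of a]
  by (auto simp: clopen_downsets_def closedin_def topspace_prime_topology double_diff
      stone_map_subset_prime_filters)
    (auto simp: stone_map_def)

section \<open>Compactness of the prime filter space\<close>

text \<open>The filter and the ideal below are described by inclusions between finite intersections and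
  unions of basic sets, so that an element common to both is itself a finite subcover.\<close>

lemma prime_filters_finite_subcover:
  assumes A: "A \<subseteq> carrier H" and B: "B \<subseteq> carrier H"
    and cover: "prime_filters H \<subseteq> (\<Union>a\<in>A. \<sigma> a) \<union> (\<Union>b\<in>B. prime_filters H - \<sigma> b)"
  obtains A' B' where "finite A'" "A' \<subseteq> A" "finite B'" "B' \<subseteq> B"
    "prime_filters H \<subseteq> (\<Union>a\<in>A'. \<sigma> a) \<union> (\<Union>b\<in>B'. prime_filters H - \<sigma> b)"
proof -
  define F where "F = {c \<in> carrier H. \<exists>B'. finite B' \<and> B' \<subseteq> B \<and>
    prime_filters H \<subseteq> \<sigma> c \<union> (\<Union>b\<in>B'. prime_filters H - \<sigma> b)}"
  define I where "I = {c \<in> carrier H. \<exists>A'. finite A' \<and> A' \<subseteq> A \<and> \<sigma> c \<subseteq> (\<Union>a\<in>A'. \<sigma> a)}"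
  have meet: "x \<sqinter> y \<in> F" if x: "x \<in> F" and y: "y \<in> F" for x y
  proof -
    obtain B1 where B1: "finite B1" "B1 \<subseteq> B"
      "prime_filters H \<subseteq> \<sigma> x \<union> (\<Union>b\<in>B1. prime_filters H - \<sigma> b)"
      using x by (auto simp: F_def)
    obtain B2 where B2: "finite B2" "B2 \<subseteq> B"
      "prime_filters H \<subseteq> \<sigma> y \<union> (\<Union>b\<in>B2. prime_filters H - \<sigma> b)"
      using y by (auto simp: F_def)
    have C: "x \<in> carrier H" "y \<in> carrier H" using x y by (auto simp: F_def)
    have "prime_filters H \<subseteq> \<sigma> (x \<sqinter> y) \<union> (\<Union>b\<in>B1 \<union> B2. prime_filters H - \<sigma> b)"
      using B1(3) B2(3) unfolding stone_map_meet[OF C] by blast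
    moreover have "finite (B1 \<union> B2)" "B1 \<union> B2 \<subseteq> B" using B1 B2 by auto
    moreover have "x \<sqinter> y \<in> carrier H" using C by simp
    ultimately show ?thesis unfolding F_def by blast
  qed
  have up: "y \<in> F" if x: "x \<in> F" and y: "y \<in> carrier H" and le: "x \<sqsubseteq> y" for x y
  proof -
    have "\<sigma> x \<subseteq> \<sigma> y" using x y le stone_map_subset_iff by (auto simp: F_def)
    then show ?thesis using x y unfolding F_def by blast
  qed
  have BF: "B \<subseteq> F"
  proof
    fix b
    assume "b \<in> B"
    then have "b \<in> carrier H" "finite {b}" "{b} \<subseteq> B"
      "prime_filters H \<subseteq> \<sigma> b \<union> (\<Union>b\<in>{b}. prime_filters H - \<sigma> b)"
      using B by auto
    then show "b \<in> F" unfolding F_def by blast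
  qed
  \<comment> \<open>The empty subfamily is a witness for \<open>\<top>\<close> here and for
    \<open>\<bottom>\<close> in \<open>I\<close> below, so \<open>F\<close> and \<open>I\<close> are
    nonempty even when \<open>A\<close> or \<open>B\<close> is empty.\<close>
  have "\<top> \<in> F" using stone_map_top by (auto simp: F_def)
  then have F: "is_filter H F"
    using meet up by (auto simp: is_filter_def F_def)
  have AI: "A \<subseteq> I"
  proof
    fix a
    assume "a \<in> A"
    then have "a \<in> carrier H" "finite {a}" "{a} \<subseteq> A" "\<sigma> a \<subseteq> (\<Union>a\<in>{a}. \<sigma> a)"
      using A by auto
    then show "a \<in> I" unfolding I_def by blast
  qed
  have "\<bottom> \<in> I" using stone_map_bottom by (auto simp: I_def)
  then have I: "I \<subseteq> carrier H" "I \<noteq> {}" by (auto simp: I_def)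
  have join: "x \<squnion> y \<in> I" if x: "x \<in> I" and y: "y \<in> I" for x y
  proof -
    obtain A1 where A1: "finite A1" "A1 \<subseteq> A" "\<sigma> x \<subseteq> (\<Union>a\<in>A1. \<sigma> a)"
      using x by (auto simp: I_def)
    obtain A2 where A2: "finite A2" "A2 \<subseteq> A" "\<sigma> y \<subseteq> (\<Union>a\<in>A2. \<sigma> a)"
      using y by (auto simp: I_def)
    have C: "x \<in> carrier H" "y \<in> carrier H" using x y by (auto simp: I_def)
    have "\<sigma> (x \<squnion> y) \<subseteq> (\<Union>a\<in>A1 \<union> A2. \<sigma> a)"
      using A1 A2 unfolding stone_map_join[OF C] by blast
    moreover have "finite (A1 \<union> A2)" "A1 \<union> A2 \<subseteq> A" using A1 A2 by auto
    moreover have "x \<squnion> y \<in> carrier H" using C by simp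
    ultimately show ?thesis unfolding I_def by blast
  qed
  \<comment> \<open>Otherwise separation gives a prime filter \<open>P\<close> that contains
    \<open>B\<close> and avoids \<open>A\<close>; such a point lies in no member of the
    cover.\<close>
  have "F \<inter> I \<noteq> {}"
  proof
    assume "F \<inter> I = {}"
    with F I join obtain P where P: "P \<in> prime_filters H" "F \<subseteq> P" "P \<inter> I = {}"
      using prime_filter_separation by blast
    then have "B \<subseteq> P" "P \<inter> A = {}" using AI BF by auto
    then show False using cover P(1) by (auto simp: stone_map_def)
  qed
  then obtain c where "c \<in> F" "c \<in> I" by blast
  then obtain A' B' where "finite A'" "A' \<subseteq> A" "\<sigma> c \<subseteq> (\<Union>a\<in>A'. \<sigma> a)"
    "finite B'" "B' \<subseteq> B" "prime_filters H \<subseteq> \<sigma> c \<union> (\<Union>b\<in>B'. prime_filters H - \<sigma> b)"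
    unfolding F_def I_def by blast
  then show ?thesis by (intro that[of A' B']) auto
qed

lemma compact_space_prime_topology: "compact_space (prime_topology H)"
  unfolding prime_topology_def
proof (rule compact_space_topology_generated_by)
  let ?B = "(\<sigma>) ` carrier H \<union> (\<lambda>a. prime_filters H - \<sigma> a) ` carrier H"
  fix C
  assume CB: "C \<subseteq> ?B" and C: "\<Union>C = \<Union>?B"
  have X: "\<Union>?B = prime_filters H"
    using topspace_prime_topology unfolding prime_topology_def by simp
  \<comment> \<open>Each member of \<open>C\<close> is a basic set, hence named by an index in
    \<open>A\<close> or in \<open>B\<close>. This turns the cover into the two families that
    \<open>prime_filters_finite_subcover\<close> treats.\<close>
  define A where "A = {a \<in> carrier H. \<sigma> a \<in> C}"
  define B where "B = {b \<in> carrier H. prime_filters H - \<sigma> b \<in> C}"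
  have "prime_filters H \<subseteq> (\<Union>a\<in>A. \<sigma> a) \<union> (\<Union>b\<in>B. prime_filters H - \<sigma> b)"
  proof
    fix P
    assume "P \<in> prime_filters H"
    then have "P \<in> \<Union>C" unfolding C X .
    then obtain S where "S \<in> C" "P \<in> S" by (rule UnionE)
    then show "P \<in> (\<Union>a\<in>A. \<sigma> a) \<union> (\<Union>b\<in>B. prime_filters H - \<sigma> b)"
      using CB unfolding A_def B_def by blast
  qed
  then obtain A' B' where AB: "finite A'" "A' \<subseteq> A" "finite B'" "B' \<subseteq> B"
    "prime_filters H \<subseteq> (\<Union>a\<in>A'. \<sigma> a) \<union> (\<Union>b\<in>B'. prime_filters H - \<sigma> b)"
    using prime_filters_finite_subcover[of A B] unfolding A_def B_def by blast
  let ?C = "(\<sigma>) ` A' \<union> (\<lambda>b. prime_filters H - \<sigma> b) ` B'"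
  have sub: "?C \<subseteq> C" using AB by (auto simp: A_def B_def)
  then have "\<Union>?C \<subseteq> \<Union>C" by blast
  moreover have "prime_filters H \<subseteq> \<Union>?C" using AB(5) by simp
  ultimately have "\<Union>?C = \<Union>?B" unfolding C X by (rule equalityI)
  then show "\<exists>C'. finite C' \<and> C' \<subseteq> C \<and> \<Union>C' = \<Union>?B"
    using sub AB(1,3) by (metis finite_UnI finite_imageI)
qed

section \<open>Clopen up-sets as values of the Stone map\<close>

lemma stone_map_finite_Union:
  assumes "finite A" "A \<subseteq> carrier H"
  shows "\<exists>c\<in>carrier H. \<sigma> c = (\<Union>a\<in>A. \<sigma> a)"
  using assms
proof (induction A)
  case empty
  then show ?case using stone_map_bottom by auto
next
  case (insert a A)
  then obtain c where "c \<in> carrier H" "\<sigma> c = (\<Union>a\<in>A. \<sigma> a)" by auto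
  then show ?case
    using insert.prems stone_map_join[of a c] by (intro bexI[of _ "a \<squnion> c"]) auto
qed

text \<open>Intersecting with \<open>prime_filters H\<close> makes the empty family yield
  \<open>\<sigma> \<top>\<close> instead of the universe of the type.\<close>

lemma stone_map_finite_Inter:
  assumes "finite A" "A \<subseteq> carrier H"
  shows "\<exists>c\<in>carrier H. \<sigma> c = prime_filters H \<inter> (\<Inter>a\<in>A. \<sigma> a)"
  using assms
proof (induction A)
  case empty
  then show ?case using stone_map_top by auto
next
  case (insert a A)
  then obtain c where "c \<in> carrier H" "\<sigma> c = prime_filters H \<inter> (\<Inter>a\<in>A. \<sigma> a)" by auto
  then show ?case
    using insert.prems stone_map_meet[of a c] by (intro bexI[of _ "a \<sqinter> c"]) auto
qed

text \<open>No \<open>P \<in> U\<close> is included in \<open>Q\<close>, since \<open>U\<close> is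
  an up-set that omits \<open>Q\<close>. So the sets \<open>\<sigma> a\<close> with
  \<open>a \<notin> Q\<close> cover \<open>U\<close>, which is compact as a closed subset of a
  compact space. A finite subcover is \<open>\<sigma>\<close> of a join, and none of its members
  contains \<open>Q\<close>.\<close>

lemma closedin_upset_separation:
  assumes closed: "closedin (prime_topology H) U"
    and up: "\<And>P Q. \<lbrakk>P \<in> U; Q \<in> prime_filters H; P \<subseteq> Q\<rbrakk> \<Longrightarrow> Q \<in> U"
    and Q: "Q \<in> prime_filters H" "Q \<notin> U"
  obtains a where "a \<in> carrier H" "U \<subseteq> \<sigma> a" "Q \<notin> \<sigma> a"
proof -
  have UX: "U \<subseteq> prime_filters H"
    using closedin_subset[OF closed] by (simp add: topspace_prime_topology)
  have "compactin (prime_topology H) U"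
    by (rule closedin_compact_space[OF compact_space_prime_topology closed])
  moreover have "\<forall>V\<in>(\<sigma>) ` (carrier H - Q). openin (prime_topology H) V"
    using openin_stone_map by auto
  moreover have "U \<subseteq> \<Union> ((\<sigma>) ` (carrier H - Q))"
  proof
    fix P
    assume P: "P \<in> U"
    then obtain a where "a \<in> P" "a \<notin> Q" using up Q by blast
    then show "P \<in> \<Union> ((\<sigma>) ` (carrier H - Q))"
      using P UX prime_filtersD(1)[of P H] by (auto simp: stone_map_def)
  qed
  ultimately obtain \<F> where "finite \<F>" "\<F> \<subseteq> (\<sigma>) ` (carrier H - Q)" "U \<subseteq> \<Union>\<F>"
    unfolding compactin_def by meson
  then obtain A where A: "finite A" "A \<subseteq> carrier H - Q" "U \<subseteq> (\<Union>a\<in>A. \<sigma> a)"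
    by (metis finite_subset_image)
  then obtain c where c: "c \<in> carrier H" "\<sigma> c = (\<Union>a\<in>A. \<sigma> a)"
    using stone_map_finite_Union[of A] by blast
  moreover have "Q \<notin> \<sigma> c"
    using A(2) unfolding c(2) by (auto simp: stone_map_def)
  ultimately show ?thesis using A(3) by (intro that[of c]) auto
qed

text \<open>Closedness of \<open>U\<close> separates it by some \<open>\<sigma> a\<close> from each
  point outside it; openness makes the complement compact. Finitely many of these
  \<open>\<sigma> a\<close> then exclude all outside points, and their intersection is
  \<open>\<sigma>\<close> of a meet.\<close>

theorem clopen_upset_is_stone_map:
  assumes "U \<in> clopen_upsets H"
  obtains a where "a \<in> carrier H" "U = \<sigma> a"
proof -
  have op: "openin (prime_topology H) U" and cl: "closedin (prime_topology H) U"
    and up: "\<And>P Q. \<lbrakk>P \<in> U; Q \<in> prime_filters H; P \<subseteq> Q\<rbrakk> \<Longrightarrow> Q \<in> U"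
    using assms by (auto simp: clopen_upsets_def)
  have UX: "U \<subseteq> prime_filters H"
    using openin_subset[OF op] by (simp add: topspace_prime_topology)
  define S where "S = {a \<in> carrier H. U \<subseteq> \<sigma> a}"
  let ?N = "\<lambda>a. prime_filters H - \<sigma> a"
  have "closedin (prime_topology H) (prime_filters H - U)"
    using op openin_closedin_eq topspace_prime_topology by metis
  then have "compactin (prime_topology H) (prime_filters H - U)"
    by (rule closedin_compact_space[OF compact_space_prime_topology])
  moreover have "\<forall>V\<in>?N ` S. openin (prime_topology H) V"
    using openin_stone_map by (auto simp: S_def)
  moreover have "prime_filters H - U \<subseteq> \<Union> (?N ` S)"
  proof
    fix Q
    assume Q: "Q \<in> prime_filters H - U"
    obtain a where "a \<in> carrier H" "U \<subseteq> \<sigma> a" "Q \<notin> \<sigma> a"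
      by (rule closedin_upset_separation[OF cl, of Q]) (use Q up in blast)+
    then show "Q \<in> \<Union> (?N ` S)" using Q by (auto simp: S_def)
  qed
  ultimately obtain \<F> where "finite \<F>" "\<F> \<subseteq> ?N ` S" "prime_filters H - U \<subseteq> \<Union>\<F>"
    unfolding compactin_def by meson
  then obtain A where A: "finite A" "A \<subseteq> S" "prime_filters H - U \<subseteq> (\<Union>a\<in>A. ?N a)"
    by (metis finite_subset_image)
  then obtain c where c: "c \<in> carrier H" "\<sigma> c = prime_filters H \<inter> (\<Inter>a\<in>A. \<sigma> a)"
    using stone_map_finite_Inter[of A] by (auto simp: S_def)
  \<comment> \<open>Every \<open>\<sigma> a\<close> with \<open>a \<in> S\<close> includes
    \<open>U\<close>, which gives one inclusion; the finite cover of the complement gives the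
    other.\<close>
  have "U = \<sigma> c"
    unfolding c(2) using A(2,3) UX by (auto simp: S_def)
  then show ?thesis using that c(1) by blast
qed

lemma stone_map_image: "(\<sigma>) ` carrier H = clopen_upsets H"
  using stone_map_clopen_upset clopen_upset_is_stone_map by blast

section \<open>The Heyting algebra of clopen up-sets\<close>

text \<open>One direction takes \<open>Q = P\<close> in \<open>upset_imp\<close>; the other uses
  that prime filters extending a point of \<open>W\<close> stay in \<open>W\<close>.\<close>

lemma upset_imp_residuation:
  assumes "W \<in> clopen_upsets H"
  shows "W \<subseteq> upset_imp H U V \<longleftrightarrow> U \<inter> W \<subseteq> V"
proof -
  have "W \<subseteq> prime_filters H" "\<And>P Q. \<lbrakk>P \<in> W; Q \<in> prime_filters H; P \<subseteq> Q\<rbrakk> \<Longrightarrow> Q \<in> W"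
    using assms openin_subset[of "prime_topology H" W]
    by (auto simp: clopen_upsets_def topspace_prime_topology)
  then show ?thesis unfolding upset_imp_def by blast
qed

end

lemma upset_algebra_simps [simp]:
  "carrier (upset_algebra M) = clopen_upsets M"
  "le (upset_algebra M) = (\<subseteq>)"
  "eq (upset_algebra M) = (=)"
  "imp (upset_algebra M) = upset_imp M"
  "nec (upset_algebra M) = nbhd_nec M (eta_nec M)"
  "poss (upset_algebra M) = nbhd_poss M (eta_poss M)"
  by (simp_all add: upset_algebra_def)

lemma bounded_lattice_upset_algebra:
  assumes "heyting_algebra M"
  shows "Lattice.bounded_lattice (upset_algebra M)"
proof -
  interpret heyting_algebra M by fact
  interpret A: partial_order "upset_algebra M" by (rule partial_order_upset_algebra)
  show ?thesis
  proof unfold_locales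
    fix U V
    assume "U \<in> carrier (upset_algebra M)" "V \<in> carrier (upset_algebra M)"
    then have UV: "U \<in> clopen_upsets M" "V \<in> clopen_upsets M" by simp_all
    have "U \<union> V \<in> clopen_upsets M" "U \<inter> V \<in> clopen_upsets M"
      using UV by (auto simp: clopen_upsets_def)
    then have "least (upset_algebra M) (U \<union> V) (Upper (upset_algebra M) {U, V})"
      "greatest (upset_algebra M) (U \<inter> V) (Lower (upset_algebra M) {U, V})"
      using UV by (auto simp: least_def Upper_def greatest_def Lower_def)
    then show "\<exists>s. least (upset_algebra M) s (Upper (upset_algebra M) {U, V})"
      "\<exists>s. greatest (upset_algebra M) s (Lower (upset_algebra M) {U, V})"
      by blast+
  next
    \<comment> \<open>The bounds \<open>{}\<close> and \<open>prime_filters M\<close> are known to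
      be clopen up-sets because they are the values of the Stone map at \<open>\<bottom>\<close> and
      \<open>\<top>\<close>.\<close>
    have "\<sigma>\<^bsub>M\<^esub> \<bottom>\<^bsub>M\<^esub> \<in> clopen_upsets M" by (intro stone_map_clopen_upset) simp
    then show "\<exists>x. least (upset_algebra M) x (carrier (upset_algebra M))"
      by (intro exI[of _ "{}"]) (auto simp: least_def stone_map_bottom)
  next
    have "\<sigma>\<^bsub>M\<^esub> \<top>\<^bsub>M\<^esub> \<in> clopen_upsets M" by (intro stone_map_clopen_upset) simp
    moreover have "U \<subseteq> prime_filters M" if "U \<in> clopen_upsets M" for U
      using that openin_subset[of "prime_topology M" U]
      by (auto simp: clopen_upsets_def topspace_prime_topology)
    ultimately show "\<exists>x. greatest (upset_algebra M) x (carrier (upset_algebra M))"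
      by (intro exI[of _ "prime_filters M"]) (auto simp: greatest_def stone_map_top)
  qed
qed

lemma heyting_algebra_upset_algebra:
  assumes "heyting_algebra M"
  shows "heyting_algebra (upset_algebra M)"
proof -
  interpret heyting_algebra M by fact
  interpret A: Lattice.bounded_lattice "upset_algebra M"
    by (rule bounded_lattice_upset_algebra) fact
  show ?thesis
  proof unfold_locales
    fix U V
    assume "U \<in> carrier (upset_algebra M)" "V \<in> carrier (upset_algebra M)"
    then have UV: "U \<in> clopen_upsets M" "V \<in> clopen_upsets M" by simp_all
    \<comment> \<open>Clopenness of \<open>upset_imp M U V\<close> is not argued topologically: with
      both arguments represented, \<open>stone_map_imp\<close> makes it the value at
      \<open>a \<rightharpoonup> b\<close>.\<close>
    obtain a b where "a \<in> carrier M" "b \<in> carrier M" "U = \<sigma>\<^bsub>M\<^esub> a" "V = \<sigma>\<^bsub>M\<^esub> b"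
      using UV clopen_upset_is_stone_map by metis
    then show "U \<rightharpoonup>\<^bsub>upset_algebra M\<^esub> V \<in> carrier (upset_algebra M)"
      using stone_map_clopen_upset[OF imp_closed] by (simp flip: stone_map_imp)
    fix W
    assume "W \<in> carrier (upset_algebra M)"
    then show "W \<sqsubseteq>\<^bsub>upset_algebra M\<^esub> U \<rightharpoonup>\<^bsub>upset_algebra M\<^esub> V \<longleftrightarrow>
        U \<sqinter>\<^bsub>upset_algebra M\<^esub> W \<sqsubseteq>\<^bsub>upset_algebra M\<^esub> V"
      using UV by (simp add: meet_upset_algebra upset_imp_residuation)
  qed
qed

lemma stone_map_heyting_hom:
  assumes "heyting_algebra M"
  shows "(\<sigma>\<^bsub>M\<^esub>) \<in> heyting_hom M (upset_algebra M)"
proof -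
  interpret heyting_algebra M by fact
  show ?thesis
    using top_upset_algebra[OF assms]
    by (auto simp: heyting_hom_def stone_map_clopen_upset stone_map_bottom stone_map_top
        bottom_upset_algebra stone_map_meet meet_upset_algebra stone_map_join join_upset_algebra
        stone_map_imp)
qed

section \<open>The modal operations and the isomorphism\<close>

context modal_heyting_algebra
begin

text \<open>\<open>\<sigma> a\<close> belongs to \<open>eta_nec M P\<close> when some
  \<open>c\<close> with \<open>\<box>c \<in> P\<close> has the same image. Injectivity forces
  \<open>c = a\<close>, so membership does not depend on the representing element.\<close>

lemma stone_map_nec:
  assumes a: "a \<in> carrier M"
  shows "\<sigma> (\<box>a) = nbhd_nec M (eta_nec M) (\<sigma> a)"
  using a inj_onD[OF inj_on_stone_map]
  unfolding nbhd_nec_def eta_nec_def stone_map_def[of _ "\<box>a"] by blast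

text \<open>The negation in \<open>nbhd_poss\<close> cancels the set difference in
  \<open>eta_poss\<close>, because the complement of \<open>\<sigma> a\<close> is a clopen down-set.
  What remains is that this complement arises from some \<open>c\<close> with
  \<open>\<diamond>c \<in> P\<close>.\<close>

lemma stone_map_poss:
  assumes a: "a \<in> carrier M"
  shows "\<sigma> (\<diamond>a) = nbhd_poss M (eta_poss M) (\<sigma> a)"
proof -
  \<comment> \<open>Complementing once more within \<open>prime_filters M\<close> recovers
    \<open>\<sigma> a = \<sigma> c\<close>, and injectivity applies.\<close>
  have "c = a" if "c \<in> carrier M" "prime_filters M - \<sigma> a = prime_filters M - \<sigma> c" for c
    using that a inj_onD[OF inj_on_stone_map] stone_map_subset_prime_filters double_diff
    by (metis order_refl)
  then show ?thesis
    using a compl_stone_map_clopen_downset[OF a]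
    unfolding nbhd_poss_def eta_poss_def stone_map_def[of _ "\<diamond>a"] by blast
qed

text \<open>Every element of the carrier is some \<open>\<sigma> a\<close>, and
  \<open>\<sigma>\<close> commutes with all operations. Closure and the modal identity are therefore
  images of the same facts in \<open>M\<close>.\<close>

lemma modal_heyting_algebra_upset_algebra: "modal_heyting_algebra (upset_algebra M)"
proof -
  interpret A: heyting_algebra "upset_algebra M"
    by (rule heyting_algebra_upset_algebra) (rule heyting_algebra_axioms)
  let ?U = "upset_algebra M"
  note hom = stone_map_heyting_hom[OF heyting_algebra_axioms]
  show ?thesis
  proof unfold_locales
    fix U
    assume "U \<in> carrier ?U"
    then obtain a where a: "a \<in> carrier M" "U = \<sigma> a"
      using clopen_upset_is_stone_map by auto
    show "\<box>\<^bsub>?U\<^esub> U \<in> carrier ?U"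
      using a stone_map_clopen_upset[OF nec_closed] by (simp flip: stone_map_nec)
    show "\<diamond>\<^bsub>?U\<^esub> U \<in> carrier ?U"
      using a stone_map_clopen_upset[OF poss_closed] by (simp flip: stone_map_poss)
    fix V
    assume "V \<in> carrier ?U"
    then obtain b where b: "b \<in> carrier M" "V = \<sigma> b"
      using clopen_upset_is_stone_map by auto
    have neg: "\<sim>a \<in> carrier M" "\<sigma> (\<sim>a) = \<sim>\<^bsub>?U\<^esub> U"
      using a hom imp_closed by (simp_all add: neg_def heyting_hom_def)
    then have 1: "\<sim>a \<sqinter> b \<in> carrier M" "\<sigma> (\<sim>a \<sqinter> b) = \<sim>\<^bsub>?U\<^esub> U \<sqinter>\<^bsub>?U\<^esub> V"
      using b hom by (simp_all add: heyting_hom_def)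
    have "\<box>\<^bsub>?U\<^esub> U \<sqinter>\<^bsub>?U\<^esub> \<diamond>\<^bsub>?U\<^esub> (\<sim>\<^bsub>?U\<^esub> U \<sqinter>\<^bsub>?U\<^esub> V) = \<sigma> (\<box>a) \<sqinter>\<^bsub>?U\<^esub> \<sigma> (\<diamond>(\<sim>a \<sqinter> b))"
      using a 1 by (simp add: stone_map_nec stone_map_poss)
    also have "\<dots> = \<sigma> (\<box>a \<sqinter> \<diamond>(\<sim>a \<sqinter> b))"
      using hom a 1 nec_closed poss_closed by (simp add: heyting_hom_def)
    also have "\<dots> = \<bottom>\<^bsub>?U\<^esub>"
      using hom nec_poss a b by (simp add: heyting_hom_def)
    finally show "\<box>\<^bsub>?U\<^esub> U \<sqinter>\<^bsub>?U\<^esub> \<diamond>\<^bsub>?U\<^esub> (\<sim>\<^bsub>?U\<^esub> U \<sqinter>\<^bsub>?U\<^esub> V) = \<bottom>\<^bsub>?U\<^esub>" .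
  qed
qed

end

text \<open>\<open>modal_heyting_iso\<close> asks only for a bijection that preserves the
  operations, so the first conjunct records separately that the target is itself a modal Heyting
  algebra.\<close>

theorem theorem15:
  fixes M :: "('a, 'm) modal_heyting_scheme"
  assumes "modal_heyting_algebra M"
  shows "modal_heyting_algebra (upset_algebra M) \<and>
    (\<sigma>\<^bsub>M\<^esub>) \<in> modal_heyting_iso M (upset_algebra M)"
proof -
  interpret modal_heyting_algebra M by fact
  have "(\<sigma>\<^bsub>M\<^esub>) \<in> modal_heyting_iso M (upset_algebra M)"
    using stone_map_heyting_hom[OF heyting_algebra_axioms] inj_on_stone_map stone_map_image
    by (simp add: modal_heyting_iso_def modal_heyting_hom_def bij_betw_def stone_map_nec
        stone_map_poss)
  then show ?thesis
    using modal_heyting_algebra_upset_algebra by blast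
qed

end
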